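(* Let $\mathcal A$ be a unital involutive algebra and let $\mathcal S\subseteq\mathcal A$ be an Ore set such that $\mathcal S^\dagger=\mathcal S$. Let $\mathcal A\mathcal S^{-1}$ be the Ore localization, with elements $[a,s]$ for $(a,s)\in\mathcal A\times\mathcal S$, and let $\ell:\mathcal A\to\mathcal A\mathcal S^{-1}$, $\ell(a)=[a,1]$. Then the map $(\cdot)^\dagger:\mathcal A\mathcal S^{-1}\to\mathcal A\mathcal S^{-1}$ defined by $$[a,s]^\dagger=[1,s^\dagger]\,[a^\dagger,1]$$ is an involution, and $\ell:\mathcal A\to\mathcal A\mathcal S^{-1}$ is a morphism of unital involutive algebras.
   Context: Algebras are complex and associative. An involution on an algebra is an antilinear map $(\cdot)^\dagger$ with $(xy)^\dagger=y^\dagger x^\dagger$ and $x^{\dagger\dagger}=x$; an involutive algebra is an algebra with an involution. A subset $\mathcal S\subseteq\mathcal A$ is an Ore set if it is multiplicative (it contains $1$ and is closed under multiplication) and for all $(a,s)\in\mathcal A\times\mathcal S$ there exist $(b,t),(b',t')\in\mathcal A\times\mathcal S$ with $at=sb$ and $t'a=b's$. Ore localization: on $\mathcal A\times\mathcal S$ put $(a,s)\sim(b,t)$ iff there exist $u,v\in\mathcal A$ with $(au,su)=(bv,tv)\in\mathcal A\times\mathcal S$. Denote by $[a,s]$ the class of $(a,s)$ and let $\mathcal A\mathcal S^{-1}=(\mathcal A\times\mathcal S)/\sim$. It is given the structure of a unital algebra, with unit $[1,1]$, by the following operations. For $\lambda\in\mathbb C$, $\lambda[a_1,s_1]+[a_2,s_2]=[\lambda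 a_1t+a_2b,\,s_1t]$, where $(b,t)\in\mathcal A\times\mathcal S$ is chosen with $s_1t=s_2b$. The product is $[a_1,s_1]\cdot[a_2,s_2]=[a_1b,\,s_2t]$, where $(b,t)\in\mathcal A\times\mathcal S$ is chosen with $a_2t=s_1b$.
   Formalization: It is additionally assumed that ~ is an equivalence relation and the operation formulas on the Ore localization are independent of choices; for Ore sets as defined this means: sa=0 with s in S implies at=0 for some t in S. This does not follow from the stated definition, even if S†=S. *)

theory Defs
  imports Complex_Main "HOL-Algebra.Module"
begin

abbreviation complex_ring :: "complex ring"
  where "complex_ring \<equiv> \<lparr>carrier = UNIV, mult = (*), one = 1, zero = 0, add = (+)\<rparr>"

text \<open>
  The library locale \<open>algebra\<close> is restricted to commutative algebras. Neither \<open>ring\<close> nor the locale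
  below excludes the zero algebra, which does occur as a localization (namely when \<open>0 \<in> S\<close>).
\<close>

locale complex_algebra =
  module complex_ring A + ring A
  for A :: "(complex, 'a, 'm) module_scheme" (structure) +
  assumes smult_mult_left:
      "\<lbrakk>x \<in> carrier A; y \<in> carrier A\<rbrakk> \<Longrightarrow> (c \<odot>\<^bsub>A\<^esub> x) \<otimes>\<^bsub>A\<^esub> y = c \<odot>\<^bsub>A\<^esub> (x \<otimes>\<^bsub>A\<^esub> y)"
    and smult_mult_right:
      "\<lbrakk>x \<in> carrier A; y \<in> carrier A\<rbrakk> \<Longrightarrow> x \<otimes>\<^bsub>A\<^esub> (c \<odot>\<^bsub>A\<^esub> y) = c \<odot>\<^bsub>A\<^esub> (x \<otimes>\<^bsub>A\<^esub> y)"

locale involutive_algebra = complex_algebra A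
  for A :: "(complex, 'a, 'm) module_scheme" (structure) and star :: "'a \<Rightarrow> 'a" +
  assumes star_closed: "x \<in> carrier A \<Longrightarrow> star x \<in> carrier A"
    and star_add: "\<lbrakk>x \<in> carrier A; y \<in> carrier A\<rbrakk> \<Longrightarrow> star (x \<oplus>\<^bsub>A\<^esub> y) = star x \<oplus>\<^bsub>A\<^esub> star y"
    and star_smult: "x \<in> carrier A \<Longrightarrow> star (c \<odot>\<^bsub>A\<^esub> x) = cnj c \<odot>\<^bsub>A\<^esub> star x"
    and star_mult: "\<lbrakk>x \<in> carrier A; y \<in> carrier A\<rbrakk> \<Longrightarrow> star (x \<otimes>\<^bsub>A\<^esub> y) = star y \<otimes>\<^bsub>A\<^esub> star x"
    and star_star: "x \<in> carrier A \<Longrightarrow> star (star x) = x"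

text \<open>The library's \<open>ring_hom\<close> includes preservation of the unit.\<close>

definition involutive_algebra_hom ::
  "(complex, 'a, 'm) module_scheme \<Rightarrow> ('a \<Rightarrow> 'a) \<Rightarrow>
   (complex, 'b, 'n) module_scheme \<Rightarrow> ('b \<Rightarrow> 'b) \<Rightarrow> ('a \<Rightarrow> 'b) set"
  where "involutive_algebra_hom A star B star' =
    {h \<in> ring_hom A B.
      (\<forall>c. \<forall>x \<in> carrier A. h (c \<odot>\<^bsub>A\<^esub> x) = c \<odot>\<^bsub>B\<^esub> h x) \<and>
      (\<forall>x \<in> carrier A. h (star x) = star' (h x))}"

definition ore_set :: "('a, 'm) ring_scheme \<Rightarrow> 'a set \<Rightarrow> bool"
  where "ore_set A S \<longleftrightarrow>
    submonoid S A \<and>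
    (\<forall>a \<in> carrier A. \<forall>s \<in> S.
      (\<exists>b \<in> carrier A. \<exists>t \<in> S. a \<otimes>\<^bsub>A\<^esub> t = s \<otimes>\<^bsub>A\<^esub> b) \<and>
      (\<exists>b' \<in> carrier A. \<exists>t' \<in> S. t' \<otimes>\<^bsub>A\<^esub> a = b' \<otimes>\<^bsub>A\<^esub> s))"

definition ore_rel :: "('a, 'm) ring_scheme \<Rightarrow> 'a set \<Rightarrow> (('a \<times> 'a) \<times> ('a \<times> 'a)) set"
  where "ore_rel A S =
    {((a, s), (b, t)). (a, s) \<in> carrier A \<times> S \<and> (b, t) \<in> carrier A \<times> S \<and>
      (\<exists>u \<in> carrier A. \<exists>v \<in> carrier A.
        (a \<otimes>\<^bsub>A\<^esub> u, s \<otimes>\<^bsub>A\<^esub> u) = (b \<otimes>\<^bsub>A\<^esub> v, t \<otimes>\<^bsub>A\<^esub> v) \<and>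
        (a \<otimes>\<^bsub>A\<^esub> u, s \<otimes>\<^bsub>A\<^esub> u) \<in> carrier A \<times> S)}"

definition ore_frac :: "('a, 'm) ring_scheme \<Rightarrow> 'a set \<Rightarrow> 'a \<Rightarrow> 'a \<Rightarrow> ('a \<times> 'a) set"
  where "ore_frac A S a s = ore_rel A S `` {(a, s)}"

text \<open>
  All values that the formulas for \<open>c \<cdot> X + Y\<close> and \<open>X \<cdot> Y\<close> can take, over all representatives of the
  classes \<open>X\<close>, \<open>Y\<close> and all admissible auxiliary pairs \<open>(b, t)\<close>. The operations are the unique
  elements of these sets.
\<close>

definition ore_lincomb_values ::
  "(complex, 'a, 'm) module_scheme \<Rightarrow> 'a set \<Rightarrow> complex \<Rightarrow>
   ('a \<times> 'a) set \<Rightarrow> ('a \<times> 'a) set \<Rightarrow> ('a \<times> 'a) set set"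
  where "ore_lincomb_values A S c X Y =
    {ore_frac A S (c \<odot>\<^bsub>A\<^esub> (a1 \<otimes>\<^bsub>A\<^esub> t) \<oplus>\<^bsub>A\<^esub> a2 \<otimes>\<^bsub>A\<^esub> b) (s1 \<otimes>\<^bsub>A\<^esub> t) | a1 s1 a2 s2 b t.
      (a1, s1) \<in> X \<and> (a2, s2) \<in> Y \<and> b \<in> carrier A \<and> t \<in> S \<and> s1 \<otimes>\<^bsub>A\<^esub> t = s2 \<otimes>\<^bsub>A\<^esub> b}"

definition ore_mult_values ::
  "('a, 'm) ring_scheme \<Rightarrow> 'a set \<Rightarrow> ('a \<times> 'a) set \<Rightarrow> ('a \<times> 'a) set \<Rightarrow> ('a \<times> 'a) set set"
  where "ore_mult_values A S X Y =
    {ore_frac A S (a1 \<otimes>\<^bsub>A\<^esub> b) (s2 \<otimes>\<^bsub>A\<^esub> t) | a1 s1 a2 s2 b t.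
      (a1, s1) \<in> X \<and> (a2, s2) \<in> Y \<and> b \<in> carrier A \<and> t \<in> S \<and> a2 \<otimes>\<^bsub>A\<^esub> t = s1 \<otimes>\<^bsub>A\<^esub> b}"

definition ore_localization ::
  "(complex, 'a, 'm) module_scheme \<Rightarrow> 'a set \<Rightarrow> (complex, ('a \<times> 'a) set) module"
  where "ore_localization A S =
    \<lparr>carrier = (carrier A \<times> S) // ore_rel A S,
     mult = (\<lambda>X Y. the_elem (ore_mult_values A S X Y)),
     one = ore_frac A S \<one>\<^bsub>A\<^esub> \<one>\<^bsub>A\<^esub>,
     zero = ore_frac A S \<zero>\<^bsub>A\<^esub> \<one>\<^bsub>A\<^esub>,
     add = (\<lambda>X Y. the_elem (ore_lincomb_values A S 1 X Y)),
     smult = (\<lambda>c X. the_elem (ore_lincomb_values A S c X (ore_frac A S \<zero>\<^bsub>A\<^esub> \<one>\<^bsub>A\<^esub>)))\<rparr>"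

text \<open>
  That the construction makes sense: \<open>ore_rel\<close> is an equivalence relation, and the formulas for the
  operations do not depend on representatives and auxiliary choices. This does not follow from
  \<open>ore_set\<close>, not even for sets stable under an involution; for Ore sets it is equivalent to right
  reversibility, see \<open>ore_localization_well_defined_iff\<close>. Counterexample: let \<open>E\<close> be the linear
  endomorphisms of \<open>\<complex>[X]\<close> and \<open>y \<in> E\<close> the shift deleting the constant coefficient (\<open>1 \<mapsto> 0\<close>,
  \<open>X\<^sup>n\<^sup>+\<^sup>1 \<mapsto> X\<^sup>n\<close>). In \<open>E \<times> E\<^sup>o\<^sup>p\<close>, with scalars acting by conjugates on the second factor and the
  swap as involution, the powers of \<open>(y, y)\<close> form an Ore set. If \<open>e\<close> is the projection onto the
  constants, then \<open>(y, y) (e, 0) = 0\<close> but \<open>(e, 0) (y, y)\<^sup>n \<noteq> 0\<close> for all \<open>n\<close>.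
\<close>

definition ore_localization_well_defined ::
  "(complex, 'a, 'm) module_scheme \<Rightarrow> 'a set \<Rightarrow> bool"
  where "ore_localization_well_defined A S \<longleftrightarrow>
    equiv (carrier A \<times> S) (ore_rel A S) \<and>
    (\<forall>X \<in> (carrier A \<times> S) // ore_rel A S. \<forall>Y \<in> (carrier A \<times> S) // ore_rel A S.
      (\<forall>c. is_singleton (ore_lincomb_values A S c X Y)) \<and>
      is_singleton (ore_mult_values A S X Y))"

definition ore_star ::
  "(complex, 'a, 'm) module_scheme \<Rightarrow> 'a set \<Rightarrow> ('a \<Rightarrow> 'a) \<Rightarrow> ('a \<times> 'a) set \<Rightarrow> ('a \<times> 'a) set"
  where "ore_star A S star X =
    the_elem {ore_frac A S \<one>\<^bsub>A\<^esub> (star s) \<otimes>\<^bsub>ore_localization A S\<^esub> ore_frac A S (star a) \<one>\<^bsub>A\<^esub> | a s.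
      (a, s) \<in> X}"


lemma ore_localization_well_defined_iff:
  fixes A :: "(complex, 'a, 'm) module_scheme"
  assumes "complex_algebra A" and ore: "ore_set A S"
  shows "ore_localization_well_defined A S \<longleftrightarrow>
    (\<forall>s \<in> S. \<forall>a \<in> carrier A. s \<otimes>\<^bsub>A\<^esub> a = \<zero>\<^bsub>A\<^esub> \<longrightarrow> (\<exists>t \<in> S. a \<otimes>\<^bsub>A\<^esub> t = \<zero>\<^bsub>A\<^esub>))"
    (is "?W \<longleftrightarrow> ?R")
proof -
  interpret complex_algebra A by fact
  interpret S: submonoid S A using ore by (simp add: ore_set_def)
  have smc [simp]: "c \<odot>\<^bsub>A\<^esub> x \<in> carrier A" if "x \<in> carrier A" for c x
    using that smult_closed by simp
  have right_ore: "\<exists>b \<in> carrier A. \<exists>t \<in> S. a \<otimes>\<^bsub>A\<^esub> t = s \<otimes>\<^bsub>A\<^esub> b"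
    if "a \<in> carrier A" "s \<in> S" for a s
    using ore that by (simp add: ore_set_def)
  have relI: "((a, s), (b, t)) \<in> ore_rel A S"
    if "a \<in> carrier A" "s \<in> S" "b \<in> carrier A" "t \<in> S" "u \<in> carrier A" "v \<in> carrier A"
      "a \<otimes>\<^bsub>A\<^esub> u = b \<otimes>\<^bsub>A\<^esub> v" "s \<otimes>\<^bsub>A\<^esub> u = t \<otimes>\<^bsub>A\<^esub> v" "s \<otimes>\<^bsub>A\<^esub> u \<in> S" for a s b t u v
    using that by (simp add: ore_rel_def) metis
  have relE: "\<exists>u \<in> carrier A. \<exists>v \<in> carrier A. a \<otimes>\<^bsub>A\<^esub> u = b \<otimes>\<^bsub>A\<^esub> v \<and> s \<otimes>\<^bsub>A\<^esub> u = t \<otimes>\<^bsub>A\<^esub> v \<and>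
      s \<otimes>\<^bsub>A\<^esub> u \<in> S \<and> a \<in> carrier A \<and> b \<in> carrier A \<and> s \<in> S \<and> t \<in> S"
    if "((a, s), (b, t)) \<in> ore_rel A S" for a s b t
    using that unfolding ore_rel_def by auto
  show ?thesis
  proof
    assume W: ?W
    have eq: "equiv (carrier A \<times> S) (ore_rel A S)"
      using W by (simp add: ore_localization_well_defined_def)
    have self: "(a, s) \<in> ore_frac A S a s" if "a \<in> carrier A" "s \<in> S" for a s
      using that equiv_class_self[OF eq] by (simp add: ore_frac_def)
    have cls: "ore_frac A S a s \<in> (carrier A \<times> S) // ore_rel A S"
      if "a \<in> carrier A" "s \<in> S" for a s
      using that by (auto simp: ore_frac_def intro: quotientI)
    have lin: "Z = Z'" if "Z \<in> ore_lincomb_values A S c X Y" "Z' \<in> ore_lincomb_values A S c X Y"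
        "X \<in> (carrier A \<times> S) // ore_rel A S" "Y \<in> (carrier A \<times> S) // ore_rel A S" for Z Z' c X Y
      using W that unfolding ore_localization_well_defined_def is_singleton_def by (metis singletonD)
    have mul: "Z = Z'" if "Z \<in> ore_mult_values A S X Y" "Z' \<in> ore_mult_values A S X Y"
        "X \<in> (carrier A \<times> S) // ore_rel A S" "Y \<in> (carrier A \<times> S) // ore_rel A S" for Z Z' X Y
      using W that unfolding ore_localization_well_defined_def is_singleton_def by (metis singletonD)
    show ?R
    proof (intro ballI impI)
      fix s a assume s: "s \<in> S" and a: "a \<in> carrier A" and sa: "s \<otimes>\<^bsub>A\<^esub> a = \<zero>\<^bsub>A\<^esub>"
      have "((\<one>\<^bsub>A\<^esub>, s), (\<one>\<^bsub>A\<^esub> \<oplus>\<^bsub>A\<^esub> a, s)) \<in> ore_rel A S"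
        by (rule relI[where u = "\<one>\<^bsub>A\<^esub> \<oplus>\<^bsub>A\<^esub> a" and v = "\<one>\<^bsub>A\<^esub>"]) (use s a sa in \<open>auto simp: r_distr\<close>)
      then have m: "(\<one>\<^bsub>A\<^esub> \<oplus>\<^bsub>A\<^esub> a, s) \<in> ore_frac A S \<one>\<^bsub>A\<^esub> s"
        by (simp add: ore_frac_def)
      define d where "d = (- 1) \<odot>\<^bsub>A\<^esub> \<one>\<^bsub>A\<^esub>"
      have d: "d \<in> carrier A" "d \<oplus>\<^bsub>A\<^esub> \<one>\<^bsub>A\<^esub> = \<zero>\<^bsub>A\<^esub>"
        using smult_l_distr[of "- 1" 1 "\<one>\<^bsub>A\<^esub>"] smult_l_null[of "\<one>\<^bsub>A\<^esub>"] smult_one[of "\<one>\<^bsub>A\<^esub>"]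
        by (auto simp: d_def)
      have v1: "ore_frac A S (d \<oplus>\<^bsub>A\<^esub> \<one>\<^bsub>A\<^esub>) s
          \<in> ore_lincomb_values A S (- 1) (ore_frac A S \<one>\<^bsub>A\<^esub> s) (ore_frac A S \<one>\<^bsub>A\<^esub> s)"
        unfolding ore_lincomb_values_def mem_Collect_eq
        by (rule exI[of _ "\<one>\<^bsub>A\<^esub>"], rule exI[of _ s], rule exI[of _ "\<one>\<^bsub>A\<^esub>"], rule exI[of _ s],
            rule exI[of _ "\<one>\<^bsub>A\<^esub>"], rule exI[of _ "\<one>\<^bsub>A\<^esub>"]) (use s self in \<open>simp add: d_def\<close>)
      have v2: "ore_frac A S (d \<oplus>\<^bsub>A\<^esub> (\<one>\<^bsub>A\<^esub> \<oplus>\<^bsub>A\<^esub> a)) s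
          \<in> ore_lincomb_values A S (- 1) (ore_frac A S \<one>\<^bsub>A\<^esub> s) (ore_frac A S \<one>\<^bsub>A\<^esub> s)"
        unfolding ore_lincomb_values_def mem_Collect_eq
        by (rule exI[of _ "\<one>\<^bsub>A\<^esub>"], rule exI[of _ s], rule exI[of _ "\<one>\<^bsub>A\<^esub> \<oplus>\<^bsub>A\<^esub> a"], rule exI[of _ s],
            rule exI[of _ "\<one>\<^bsub>A\<^esub>"], rule exI[of _ "\<one>\<^bsub>A\<^esub>"]) (use s a self m in \<open>simp add: d_def\<close>)
      have "d \<oplus>\<^bsub>A\<^esub> (\<one>\<^bsub>A\<^esub> \<oplus>\<^bsub>A\<^esub> a) = a"
        using d a by (simp flip: a_assoc)
      then have "ore_frac A S \<zero>\<^bsub>A\<^esub> s = ore_frac A S a s"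
        using lin[OF v1 v2] cls s d by simp
      then have m2: "(a, s) \<in> ore_frac A S \<zero>\<^bsub>A\<^esub> s"
        using self a s by simp
      have w1: "ore_frac A S \<zero>\<^bsub>A\<^esub> \<one>\<^bsub>A\<^esub>
          \<in> ore_mult_values A S (ore_frac A S \<zero>\<^bsub>A\<^esub> s) (ore_frac A S s \<one>\<^bsub>A\<^esub>)"
        unfolding ore_mult_values_def mem_Collect_eq
        by (rule exI[of _ "\<zero>\<^bsub>A\<^esub>"], rule exI[of _ s], rule exI[of _ s], rule exI[of _ "\<one>\<^bsub>A\<^esub>"],
            rule exI[of _ "\<one>\<^bsub>A\<^esub>"], rule exI[of _ "\<one>\<^bsub>A\<^esub>"]) (use s self in simp)
      have w2: "ore_frac A S a \<one>\<^bsub>A\<^esub>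
          \<in> ore_mult_values A S (ore_frac A S \<zero>\<^bsub>A\<^esub> s) (ore_frac A S s \<one>\<^bsub>A\<^esub>)"
        unfolding ore_mult_values_def mem_Collect_eq
        by (rule exI[of _ a], rule exI[of _ s], rule exI[of _ s], rule exI[of _ "\<one>\<^bsub>A\<^esub>"],
            rule exI[of _ "\<one>\<^bsub>A\<^esub>"], rule exI[of _ "\<one>\<^bsub>A\<^esub>"]) (use s a self m2 in simp)
      have "ore_frac A S a \<one>\<^bsub>A\<^esub> = ore_frac A S \<zero>\<^bsub>A\<^esub> \<one>\<^bsub>A\<^esub>"
        using mul[OF w2 w1] cls s by simp
      then have "(\<zero>\<^bsub>A\<^esub>, \<one>\<^bsub>A\<^esub>) \<in> ore_frac A S a \<one>\<^bsub>A\<^esub>"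
        using self by simp
      then have "((a, \<one>\<^bsub>A\<^esub>), (\<zero>\<^bsub>A\<^esub>, \<one>\<^bsub>A\<^esub>)) \<in> ore_rel A S"
        by (simp add: ore_frac_def)
      from relE[OF this] show "\<exists>t \<in> S. a \<otimes>\<^bsub>A\<^esub> t = \<zero>\<^bsub>A\<^esub>"
        by auto
    qed
  next
    assume R: ?R
    have cancel: "\<exists>t \<in> S. u \<otimes>\<^bsub>A\<^esub> t = v \<otimes>\<^bsub>A\<^esub> t"
      if "s \<in> S" "u \<in> carrier A" "v \<in> carrier A" "s \<otimes>\<^bsub>A\<^esub> u = s \<otimes>\<^bsub>A\<^esub> v" for s u v
    proof -
      have "s \<otimes>\<^bsub>A\<^esub> (u \<ominus>\<^bsub>A\<^esub> v) = s \<otimes>\<^bsub>A\<^esub> u \<ominus>\<^bsub>A\<^esub> s \<otimes>\<^bsub>A\<^esub> v"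
        using that by (simp add: minus_eq r_distr r_minus)
      also have "\<dots> = \<zero>\<^bsub>A\<^esub>"
        using that by (simp add: minus_eq r_neg)
      finally have "\<exists>t \<in> S. (u \<ominus>\<^bsub>A\<^esub> v) \<otimes>\<^bsub>A\<^esub> t = \<zero>\<^bsub>A\<^esub>"
        using R that minus_closed[of u v] by blast
      then obtain t where t: "t \<in> S" "(u \<ominus>\<^bsub>A\<^esub> v) \<otimes>\<^bsub>A\<^esub> t = \<zero>\<^bsub>A\<^esub>"
        by blast
      then have "u \<otimes>\<^bsub>A\<^esub> t \<ominus>\<^bsub>A\<^esub> v \<otimes>\<^bsub>A\<^esub> t = \<zero>\<^bsub>A\<^esub>"
        using that by (simp add: minus_eq l_distr l_minus)
      then have "u \<otimes>\<^bsub>A\<^esub> t = v \<otimes>\<^bsub>A\<^esub> t"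
        using that t minus_equality[of "u \<otimes>\<^bsub>A\<^esub> t" "\<ominus>\<^bsub>A\<^esub> (v \<otimes>\<^bsub>A\<^esub> t)"]
        by (simp add: minus_eq minus_minus)
      with t show ?thesis by blast
    qed
    have key: "\<exists>w \<in> S. a \<otimes>\<^bsub>A\<^esub> (x \<otimes>\<^bsub>A\<^esub> w) = b \<otimes>\<^bsub>A\<^esub> (y \<otimes>\<^bsub>A\<^esub> w)"
      if rel: "((a, s), (b, t)) \<in> ore_rel A S" and x: "x \<in> carrier A" and y: "y \<in> carrier A"
        and xy: "s \<otimes>\<^bsub>A\<^esub> x = t \<otimes>\<^bsub>A\<^esub> y" for a s b t x y
    proof -
      from relE[OF rel] obtain u v where
        [simp]: "u \<in> carrier A" "v \<in> carrier A" "a \<in> carrier A" "b \<in> carrier A" "s \<in> S" "t \<in> S"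
        and au: "a \<otimes>\<^bsub>A\<^esub> u = b \<otimes>\<^bsub>A\<^esub> v" and su: "s \<otimes>\<^bsub>A\<^esub> u = t \<otimes>\<^bsub>A\<^esub> v" "s \<otimes>\<^bsub>A\<^esub> u \<in> S"
        by blast
      note [simp] = x y
      obtain p q where [simp]: "p \<in> carrier A" "q \<in> S"
        and pq: "(s \<otimes>\<^bsub>A\<^esub> x) \<otimes>\<^bsub>A\<^esub> q = (s \<otimes>\<^bsub>A\<^esub> u) \<otimes>\<^bsub>A\<^esub> p"
        using right_ore[OF _ su(2), of "s \<otimes>\<^bsub>A\<^esub> x"] by auto
      obtain t1 where [simp]: "t1 \<in> S" and t1: "(x \<otimes>\<^bsub>A\<^esub> q) \<otimes>\<^bsub>A\<^esub> t1 = (u \<otimes>\<^bsub>A\<^esub> p) \<otimes>\<^bsub>A\<^esub> t1"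
        using cancel[of s "x \<otimes>\<^bsub>A\<^esub> q" "u \<otimes>\<^bsub>A\<^esub> p"] pq by (auto simp: m_assoc)
      have "t \<otimes>\<^bsub>A\<^esub> (y \<otimes>\<^bsub>A\<^esub> q) = t \<otimes>\<^bsub>A\<^esub> (v \<otimes>\<^bsub>A\<^esub> p)"
        using pq xy su(1) by (simp flip: m_assoc)
      then obtain t2 where [simp]: "t2 \<in> S" and t2: "(y \<otimes>\<^bsub>A\<^esub> q) \<otimes>\<^bsub>A\<^esub> t2 = (v \<otimes>\<^bsub>A\<^esub> p) \<otimes>\<^bsub>A\<^esub> t2"
        using cancel[of t "y \<otimes>\<^bsub>A\<^esub> q" "v \<otimes>\<^bsub>A\<^esub> p"] by auto
      obtain e f where [simp]: "e \<in> carrier A" "f \<in> S" and ef: "t1 \<otimes>\<^bsub>A\<^esub> f = t2 \<otimes>\<^bsub>A\<^esub> e"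
        using right_ore[of t1 t2] by auto
      let ?w = "q \<otimes>\<^bsub>A\<^esub> (t1 \<otimes>\<^bsub>A\<^esub> f)"
      have "x \<otimes>\<^bsub>A\<^esub> ?w = ((x \<otimes>\<^bsub>A\<^esub> q) \<otimes>\<^bsub>A\<^esub> t1) \<otimes>\<^bsub>A\<^esub> f"
        by (simp add: m_assoc)
      also have "\<dots> = u \<otimes>\<^bsub>A\<^esub> (p \<otimes>\<^bsub>A\<^esub> (t1 \<otimes>\<^bsub>A\<^esub> f))"
        by (simp add: t1) (simp add: m_assoc)
      finally have 1: "x \<otimes>\<^bsub>A\<^esub> ?w = u \<otimes>\<^bsub>A\<^esub> (p \<otimes>\<^bsub>A\<^esub> (t1 \<otimes>\<^bsub>A\<^esub> f))" .
      have "y \<otimes>\<^bsub>A\<^esub> ?w = ((y \<otimes>\<^bsub>A\<^esub> q) \<otimes>\<^bsub>A\<^esub> t2) \<otimes>\<^bsub>A\<^esub> e"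
        by (simp add: ef) (simp add: m_assoc)
      also have "\<dots> = v \<otimes>\<^bsub>A\<^esub> (p \<otimes>\<^bsub>A\<^esub> (t1 \<otimes>\<^bsub>A\<^esub> f))"
        by (simp add: t2 ef) (simp add: m_assoc)
      finally have 2: "y \<otimes>\<^bsub>A\<^esub> ?w = v \<otimes>\<^bsub>A\<^esub> (p \<otimes>\<^bsub>A\<^esub> (t1 \<otimes>\<^bsub>A\<^esub> f))" .
      have "a \<otimes>\<^bsub>A\<^esub> (x \<otimes>\<^bsub>A\<^esub> ?w) = (a \<otimes>\<^bsub>A\<^esub> u) \<otimes>\<^bsub>A\<^esub> (p \<otimes>\<^bsub>A\<^esub> (t1 \<otimes>\<^bsub>A\<^esub> f))"
        by (simp only: 1) (simp add: m_assoc)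
      also have "\<dots> = b \<otimes>\<^bsub>A\<^esub> (y \<otimes>\<^bsub>A\<^esub> ?w)"
        by (simp only: 2 au) (simp add: m_assoc)
      finally show ?thesis
        by (intro bexI[of _ ?w]) auto
    qed
    have eq: "equiv (carrier A \<times> S) (ore_rel A S)"
    proof (rule equivI)
      show "ore_rel A S \<subseteq> (carrier A \<times> S) \<times> (carrier A \<times> S)"
        unfolding ore_rel_def by auto
      show "refl_on (carrier A \<times> S) (ore_rel A S)"
        by (rule refl_onI) (auto intro: relI[where u = "\<one>\<^bsub>A\<^esub>" and v = "\<one>\<^bsub>A\<^esub>"])
      show "sym (ore_rel A S)"
      proof (rule symI, clarify)
        fix a s b t assume "((a, s), (b, t)) \<in> ore_rel A S"
        from relE[OF this] show "((b, t), (a, s)) \<in> ore_rel A S"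
          by (metis relI)
      qed
      show "trans (ore_rel A S)"
      proof (rule transI, clarify)
        fix a s b t c r
        assume 1: "((a, s), (b, t)) \<in> ore_rel A S" and 2: "((b, t), (c, r)) \<in> ore_rel A S"
        from relE[OF 1] have [simp]: "a \<in> carrier A" "b \<in> carrier A" "s \<in> S" "t \<in> S" by auto
        from relE[OF 2] obtain u v where
          [simp]: "u \<in> carrier A" "v \<in> carrier A" "c \<in> carrier A" "r \<in> S"
          and bu: "b \<otimes>\<^bsub>A\<^esub> u = c \<otimes>\<^bsub>A\<^esub> v" and tu: "t \<otimes>\<^bsub>A\<^esub> u = r \<otimes>\<^bsub>A\<^esub> v" "t \<otimes>\<^bsub>A\<^esub> u \<in> S"
          by blast
        obtain x p where [simp]: "x \<in> carrier A" "p \<in> S" and xp: "(t \<otimes>\<^bsub>A\<^esub> u) \<otimes>\<^bsub>A\<^esub> p = s \<otimes>\<^bsub>A\<^esub> x"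
          using right_ore[of "t \<otimes>\<^bsub>A\<^esub> u" s] by auto
        obtain w where [simp]: "w \<in> S" and w: "a \<otimes>\<^bsub>A\<^esub> (x \<otimes>\<^bsub>A\<^esub> w) = b \<otimes>\<^bsub>A\<^esub> ((u \<otimes>\<^bsub>A\<^esub> p) \<otimes>\<^bsub>A\<^esub> w)"
          using key[OF 1, of x "u \<otimes>\<^bsub>A\<^esub> p"] xp by (auto simp: m_assoc)
        have sx: "s \<otimes>\<^bsub>A\<^esub> (x \<otimes>\<^bsub>A\<^esub> w) = (t \<otimes>\<^bsub>A\<^esub> u) \<otimes>\<^bsub>A\<^esub> (p \<otimes>\<^bsub>A\<^esub> w)"
          using xp by (simp flip: m_assoc)
        show "((a, s), (c, r)) \<in> ore_rel A S"
        proof (rule relI[where u = "x \<otimes>\<^bsub>A\<^esub> w" and v = "v \<otimes>\<^bsub>A\<^esub> (p \<otimes>\<^bsub>A\<^esub> w)"])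
          have "a \<otimes>\<^bsub>A\<^esub> (x \<otimes>\<^bsub>A\<^esub> w) = (b \<otimes>\<^bsub>A\<^esub> u) \<otimes>\<^bsub>A\<^esub> (p \<otimes>\<^bsub>A\<^esub> w)"
            by (simp add: w m_assoc)
          then show "a \<otimes>\<^bsub>A\<^esub> (x \<otimes>\<^bsub>A\<^esub> w) = c \<otimes>\<^bsub>A\<^esub> (v \<otimes>\<^bsub>A\<^esub> (p \<otimes>\<^bsub>A\<^esub> w))"
            by (simp add: bu m_assoc)
          show "s \<otimes>\<^bsub>A\<^esub> (x \<otimes>\<^bsub>A\<^esub> w) = r \<otimes>\<^bsub>A\<^esub> (v \<otimes>\<^bsub>A\<^esub> (p \<otimes>\<^bsub>A\<^esub> w))"
            by (simp add: sx tu(1) m_assoc)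
          show "s \<otimes>\<^bsub>A\<^esub> (x \<otimes>\<^bsub>A\<^esub> w) \<in> S"
            using tu(2) by (simp add: sx)
        qed auto
      qed
    qed
    have frac_eq: "ore_frac A S a s = ore_frac A S b t" if "((a, s), (b, t)) \<in> ore_rel A S" for a s b t
      using equiv_class_eq[OF eq that] by (simp add: ore_frac_def)
    have in_rel: "(x, y) \<in> ore_rel A S"
      if "X \<in> (carrier A \<times> S) // ore_rel A S" "x \<in> X" "y \<in> X" for X x y
      using quotient_eq_iff[OF eq that(1) that(1) that(2,3)] by simp
    have rep: "\<exists>a \<in> carrier A. \<exists>s \<in> S. (a, s) \<in> X"
      if "X \<in> (carrier A \<times> S) // ore_rel A S" for X
      using that equiv_class_self[OF eq] by (fastforce elim!: quotientE)
    show ?W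
      unfolding ore_localization_well_defined_def
    proof (intro conjI ballI allI eq)
      fix X Y assume X: "X \<in> (carrier A \<times> S) // ore_rel A S" and Y: "Y \<in> (carrier A \<times> S) // ore_rel A S"
      obtain a1 s1 a2 s2 where r1: "a1 \<in> carrier A" "s1 \<in> S" "(a1, s1) \<in> X"
        and r2: "a2 \<in> carrier A" "s2 \<in> S" "(a2, s2) \<in> Y"
        using rep[OF X] rep[OF Y] by blast
      {
        fix c
        show "is_singleton (ore_lincomb_values A S c X Y)"
        proof (rule is_singletonI')
          obtain b t where "b \<in> carrier A" "t \<in> S" "s1 \<otimes>\<^bsub>A\<^esub> t = s2 \<otimes>\<^bsub>A\<^esub> b"
            using right_ore[of s1 s2] r1 r2 by auto
          then show "ore_lincomb_values A S c X Y \<noteq> {}"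
            using r1 r2 unfolding ore_lincomb_values_def by blast
          fix Z Z' assume "Z \<in> ore_lincomb_values A S c X Y" "Z' \<in> ore_lincomb_values A S c X Y"
          then obtain a1 s1 a2 s2 b t a1' s1' a2' s2' b' t' where
            Z: "Z = ore_frac A S (c \<odot>\<^bsub>A\<^esub> (a1 \<otimes>\<^bsub>A\<^esub> t) \<oplus>\<^bsub>A\<^esub> a2 \<otimes>\<^bsub>A\<^esub> b) (s1 \<otimes>\<^bsub>A\<^esub> t)"
              "Z' = ore_frac A S (c \<odot>\<^bsub>A\<^esub> (a1' \<otimes>\<^bsub>A\<^esub> t') \<oplus>\<^bsub>A\<^esub> a2' \<otimes>\<^bsub>A\<^esub> b') (s1' \<otimes>\<^bsub>A\<^esub> t')"
            and mem: "(a1, s1) \<in> X" "(a2, s2) \<in> Y" "(a1', s1') \<in> X" "(a2', s2') \<in> Y"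
            and [simp]: "b \<in> carrier A" "t \<in> S" "b' \<in> carrier A" "t' \<in> S"
            and st: "s1 \<otimes>\<^bsub>A\<^esub> t = s2 \<otimes>\<^bsub>A\<^esub> b" "s1' \<otimes>\<^bsub>A\<^esub> t' = s2' \<otimes>\<^bsub>A\<^esub> b'"
            unfolding ore_lincomb_values_def by blast
          have rels: "((a1, s1), (a1', s1')) \<in> ore_rel A S" "((a2, s2), (a2', s2')) \<in> ore_rel A S"
            using in_rel[OF X] in_rel[OF Y] mem by blast+
          have [simp]: "a1 \<in> carrier A" "a2 \<in> carrier A" "a1' \<in> carrier A" "a2' \<in> carrier A"
            "s1 \<in> S" "s2 \<in> S" "s1' \<in> S" "s2' \<in> S"
            using relE[OF rels(1)] relE[OF rels(2)] by auto
          obtain q p where [simp]: "q \<in> carrier A" "p \<in> S"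
            and pq: "(s1 \<otimes>\<^bsub>A\<^esub> t) \<otimes>\<^bsub>A\<^esub> p = (s1' \<otimes>\<^bsub>A\<^esub> t') \<otimes>\<^bsub>A\<^esub> q"
            using right_ore[of "s1 \<otimes>\<^bsub>A\<^esub> t" "s1' \<otimes>\<^bsub>A\<^esub> t'"] by auto
          obtain w1 where [simp]: "w1 \<in> S"
            and w1: "a1 \<otimes>\<^bsub>A\<^esub> ((t \<otimes>\<^bsub>A\<^esub> p) \<otimes>\<^bsub>A\<^esub> w1) = a1' \<otimes>\<^bsub>A\<^esub> ((t' \<otimes>\<^bsub>A\<^esub> q) \<otimes>\<^bsub>A\<^esub> w1)"
            using key[OF rels(1), of "t \<otimes>\<^bsub>A\<^esub> p" "t' \<otimes>\<^bsub>A\<^esub> q"] pq by (auto simp: m_assoc)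
          have "s2 \<otimes>\<^bsub>A\<^esub> (b \<otimes>\<^bsub>A\<^esub> p \<otimes>\<^bsub>A\<^esub> w1) = s2' \<otimes>\<^bsub>A\<^esub> (b' \<otimes>\<^bsub>A\<^esub> q \<otimes>\<^bsub>A\<^esub> w1)"
            using pq st by (simp flip: m_assoc)
          then obtain w2 where [simp]: "w2 \<in> S"
            and w2: "a2 \<otimes>\<^bsub>A\<^esub> ((b \<otimes>\<^bsub>A\<^esub> p \<otimes>\<^bsub>A\<^esub> w1) \<otimes>\<^bsub>A\<^esub> w2) = a2' \<otimes>\<^bsub>A\<^esub> ((b' \<otimes>\<^bsub>A\<^esub> q \<otimes>\<^bsub>A\<^esub> w1) \<otimes>\<^bsub>A\<^esub> w2)"
            using key[OF rels(2), of "b \<otimes>\<^bsub>A\<^esub> p \<otimes>\<^bsub>A\<^esub> w1" "b' \<otimes>\<^bsub>A\<^esub> q \<otimes>\<^bsub>A\<^esub> w1"] by auto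
          let ?u = "p \<otimes>\<^bsub>A\<^esub> (w1 \<otimes>\<^bsub>A\<^esub> w2)" and ?v = "q \<otimes>\<^bsub>A\<^esub> (w1 \<otimes>\<^bsub>A\<^esub> w2)"
          have "(a1 \<otimes>\<^bsub>A\<^esub> ((t \<otimes>\<^bsub>A\<^esub> p) \<otimes>\<^bsub>A\<^esub> w1)) \<otimes>\<^bsub>A\<^esub> w2 = (a1' \<otimes>\<^bsub>A\<^esub> ((t' \<otimes>\<^bsub>A\<^esub> q) \<otimes>\<^bsub>A\<^esub> w1)) \<otimes>\<^bsub>A\<^esub> w2"
            by (simp only: w1)
          then have e1: "(a1 \<otimes>\<^bsub>A\<^esub> t) \<otimes>\<^bsub>A\<^esub> ?u = (a1' \<otimes>\<^bsub>A\<^esub> t') \<otimes>\<^bsub>A\<^esub> ?v"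
            by (simp add: m_assoc)
          have e2: "(a2 \<otimes>\<^bsub>A\<^esub> b) \<otimes>\<^bsub>A\<^esub> ?u = (a2' \<otimes>\<^bsub>A\<^esub> b') \<otimes>\<^bsub>A\<^esub> ?v"
            using w2 by (simp add: m_assoc)
          have e3: "(s1 \<otimes>\<^bsub>A\<^esub> t) \<otimes>\<^bsub>A\<^esub> ?u = (s1' \<otimes>\<^bsub>A\<^esub> t') \<otimes>\<^bsub>A\<^esub> ?v"
            using arg_cong[OF pq, of "\<lambda>z. z \<otimes>\<^bsub>A\<^esub> (w1 \<otimes>\<^bsub>A\<^esub> w2)"] by (simp add: m_assoc)
          have e4: "(s1 \<otimes>\<^bsub>A\<^esub> t) \<otimes>\<^bsub>A\<^esub> ?u \<in> S"
            by simp
          show "Z = Z'"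
            unfolding Z
            by (rule frac_eq, rule relI[where u = ?u and v = ?v])
              (use e1 e2 e3 e4 in \<open>simp_all add: l_distr smult_mult_left\<close>)
        qed
      }
      show "is_singleton (ore_mult_values A S X Y)"
      proof (rule is_singletonI')
        obtain b t where "b \<in> carrier A" "t \<in> S" "a2 \<otimes>\<^bsub>A\<^esub> t = s1 \<otimes>\<^bsub>A\<^esub> b"
          using right_ore[of a2 s1] r1 r2 by auto
        then show "ore_mult_values A S X Y \<noteq> {}"
          using r1 r2 unfolding ore_mult_values_def by blast
        fix Z Z' assume "Z \<in> ore_mult_values A S X Y" "Z' \<in> ore_mult_values A S X Y"
        then obtain a1 s1 a2 s2 b t a1' s1' a2' s2' b' t' where
          Z: "Z = ore_frac A S (a1 \<otimes>\<^bsub>A\<^esub> b) (s2 \<otimes>\<^bsub>A\<^esub> t)" "Z' = ore_frac A S (a1' \<otimes>\<^bsub>A\<^esub> b') (s2' \<otimes>\<^bsub>A\<^esub> t')"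
          and mem: "(a1, s1) \<in> X" "(a2, s2) \<in> Y" "(a1', s1') \<in> X" "(a2', s2') \<in> Y"
          and [simp]: "b \<in> carrier A" "t \<in> S" "b' \<in> carrier A" "t' \<in> S"
          and st: "a2 \<otimes>\<^bsub>A\<^esub> t = s1 \<otimes>\<^bsub>A\<^esub> b" "a2' \<otimes>\<^bsub>A\<^esub> t' = s1' \<otimes>\<^bsub>A\<^esub> b'"
          unfolding ore_mult_values_def by blast
        have rels: "((a1, s1), (a1', s1')) \<in> ore_rel A S" "((a2, s2), (a2', s2')) \<in> ore_rel A S"
          using in_rel[OF X] in_rel[OF Y] mem by blast+
        have [simp]: "a1 \<in> carrier A" "a2 \<in> carrier A" "a1' \<in> carrier A" "a2' \<in> carrier A"
          "s1 \<in> S" "s2 \<in> S" "s1' \<in> S" "s2' \<in> S"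
          using relE[OF rels(1)] relE[OF rels(2)] by auto
        obtain q p where [simp]: "q \<in> carrier A" "p \<in> S"
          and pq: "(s2 \<otimes>\<^bsub>A\<^esub> t) \<otimes>\<^bsub>A\<^esub> p = (s2' \<otimes>\<^bsub>A\<^esub> t') \<otimes>\<^bsub>A\<^esub> q"
          using right_ore[of "s2 \<otimes>\<^bsub>A\<^esub> t" "s2' \<otimes>\<^bsub>A\<^esub> t'"] by auto
        obtain w1 where [simp]: "w1 \<in> S"
          and w1: "a2 \<otimes>\<^bsub>A\<^esub> ((t \<otimes>\<^bsub>A\<^esub> p) \<otimes>\<^bsub>A\<^esub> w1) = a2' \<otimes>\<^bsub>A\<^esub> ((t' \<otimes>\<^bsub>A\<^esub> q) \<otimes>\<^bsub>A\<^esub> w1)"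
          using key[OF rels(2), of "t \<otimes>\<^bsub>A\<^esub> p" "t' \<otimes>\<^bsub>A\<^esub> q"] pq by (auto simp: m_assoc)
        have "s1 \<otimes>\<^bsub>A\<^esub> (b \<otimes>\<^bsub>A\<^esub> p \<otimes>\<^bsub>A\<^esub> w1) = s1' \<otimes>\<^bsub>A\<^esub> (b' \<otimes>\<^bsub>A\<^esub> q \<otimes>\<^bsub>A\<^esub> w1)"
          using w1 st by (simp flip: m_assoc)
        then obtain w2 where [simp]: "w2 \<in> S"
          and w2: "a1 \<otimes>\<^bsub>A\<^esub> ((b \<otimes>\<^bsub>A\<^esub> p \<otimes>\<^bsub>A\<^esub> w1) \<otimes>\<^bsub>A\<^esub> w2) = a1' \<otimes>\<^bsub>A\<^esub> ((b' \<otimes>\<^bsub>A\<^esub> q \<otimes>\<^bsub>A\<^esub> w1) \<otimes>\<^bsub>A\<^esub> w2)"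
          using key[OF rels(1), of "b \<otimes>\<^bsub>A\<^esub> p \<otimes>\<^bsub>A\<^esub> w1" "b' \<otimes>\<^bsub>A\<^esub> q \<otimes>\<^bsub>A\<^esub> w1"] by auto
        let ?u = "p \<otimes>\<^bsub>A\<^esub> (w1 \<otimes>\<^bsub>A\<^esub> w2)" and ?v = "q \<otimes>\<^bsub>A\<^esub> (w1 \<otimes>\<^bsub>A\<^esub> w2)"
        have e1: "(a1 \<otimes>\<^bsub>A\<^esub> b) \<otimes>\<^bsub>A\<^esub> ?u = (a1' \<otimes>\<^bsub>A\<^esub> b') \<otimes>\<^bsub>A\<^esub> ?v"
          using w2 by (simp add: m_assoc)
        have e2: "(s2 \<otimes>\<^bsub>A\<^esub> t) \<otimes>\<^bsub>A\<^esub> ?u = (s2' \<otimes>\<^bsub>A\<^esub> t') \<otimes>\<^bsub>A\<^esub> ?v"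
          using arg_cong[OF pq, of "\<lambda>z. z \<otimes>\<^bsub>A\<^esub> (w1 \<otimes>\<^bsub>A\<^esub> w2)"] by (simp add: m_assoc)
        have e3: "(s2 \<otimes>\<^bsub>A\<^esub> t) \<otimes>\<^bsub>A\<^esub> ?u \<in> S"
          by simp
        show "Z = Z'"
          unfolding Z
          by (rule frac_eq, rule relI[where u = ?u and v = ?v]) (use e1 e2 e3 in simp_all)
      qed
    qed
  qed
qed

end

theory Submission
  imports Defs
begin

text \<open>
  Everything in \<open>\<A>S\<^sup>-\<^sup>1\<close> is computed from \<open>[a,s] = \<ell>(a) \<ell>(s)\<^sup>-\<^sup>1\<close>. If \<open>su \<in> S\<close>, then
  \<open>\<ell>((su)\<^sup>\<dagger>) = \<ell>(u\<^sup>\<dagger>) \<ell>(s\<^sup>\<dagger>)\<close>, so \<open>\<ell>(s\<^sup>\<dagger>)\<^sup>-\<^sup>1 = \<ell>((su)\<^sup>\<dagger>)\<^sup>-\<^sup>1 \<ell>(u\<^sup>\<dagger>)\<close>, and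
  \<open>\<ell>(s\<^sup>\<dagger>)\<^sup>-\<^sup>1 \<ell>(a\<^sup>\<dagger>) = \<ell>((su)\<^sup>\<dagger>)\<^sup>-\<^sup>1 \<ell>((au)\<^sup>\<dagger>)\<close> depends on \<open>(au, su)\<close> only. Applying the dagger to the
  condition \<open>by = sx\<close> which defines a product shows that the dagger reverses products.
\<close>

section \<open>Fractions and the computation of the operations on representatives\<close>

locale ore_localizable = complex_algebra A
  for A :: "(complex, 'a, 'm) module_scheme" (structure) +
  fixes S :: "'a set"
  assumes ore: "ore_set A S"
    and well_defined: "ore_localization_well_defined A S"
begin

sublocale S: submonoid S A
  using ore by (simp add: ore_set_def)

abbreviation frac :: "'a \<Rightarrow> 'a \<Rightarrow> ('a \<times> 'a) set"
  where "frac \<equiv> ore_frac A S"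

abbreviation Q :: "(complex, ('a \<times> 'a) set) module"
  where "Q \<equiv> ore_localization A S"

lemma smult_carrier [simp]: "x \<in> carrier A \<Longrightarrow> c \<odot> x \<in> carrier A"
  using smult_closed by simp

lemma right_oreE:
  assumes "a \<in> carrier A" "s \<in> S"
  obtains b t where "b \<in> carrier A" "t \<in> S" "a \<otimes> t = s \<otimes> b"
  using ore assms unfolding ore_set_def by blast

lemma equiv_ore_rel: "equiv (carrier A \<times> S) (ore_rel A S)"
  using well_defined by (simp add: ore_localization_well_defined_def)

lemma frac_self: "\<lbrakk>a \<in> carrier A; s \<in> S\<rbrakk> \<Longrightarrow> (a, s) \<in> frac a s"
  using equiv_class_self[OF equiv_ore_rel] by (simp add: ore_frac_def)

lemma frac_closed [simp]: "\<lbrakk>a \<in> carrier A; s \<in> S\<rbrakk> \<Longrightarrow> frac a s \<in> carrier Q"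
  by (auto simp: ore_frac_def ore_localization_def intro: quotientI)

lemma fracE:
  assumes "X \<in> carrier Q"
  obtains a s where "a \<in> carrier A" "s \<in> S" "X = frac a s"
  using assms by (auto simp: ore_frac_def ore_localization_def elim!: quotientE)

lemma frac_eqI:
  assumes "a \<in> carrier A" "s \<in> S" "b \<in> carrier A" "t \<in> S" "u \<in> carrier A" "v \<in> carrier A"
    and "a \<otimes> u = b \<otimes> v" "s \<otimes> u = t \<otimes> v" "s \<otimes> u \<in> S"
  shows "frac a s = frac b t"
proof -
  have "((a, s), (b, t)) \<in> ore_rel A S"
    using assms by (simp add: ore_rel_def) metis
  then show ?thesis
    using equiv_class_eq[OF equiv_ore_rel] by (simp add: ore_frac_def)
qed

lemma mem_fracE:
  assumes "(b, t) \<in> frac a s"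
  obtains u v where "b \<in> carrier A" "t \<in> S" "u \<in> carrier A" "v \<in> carrier A"
    "a \<otimes> u = b \<otimes> v" "s \<otimes> u = t \<otimes> v" "s \<otimes> u \<in> S"
  using assms unfolding ore_frac_def ore_rel_def by auto

text \<open>Well-definedness makes the set of values a singleton, so exhibiting the value for one
  admissible pair \<open>(x, y)\<close> already determines \<open>the_elem\<close>. The same
  argument gives \<open>mult_frac\<close>; all later computations go through these two
  rules.\<close>

lemma lincomb_frac:
  assumes "a \<in> carrier A" "s \<in> S" "b \<in> carrier A" "t \<in> S" "x \<in> carrier A" "y \<in> S"
    and "s \<otimes> y = t \<otimes> x"
  shows "the_elem (ore_lincomb_values A S c (frac a s) (frac b t)) =
    frac (c \<odot> (a \<otimes> y) \<oplus> b \<otimes> x) (s \<otimes> y)"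
proof -
  have "is_singleton (ore_lincomb_values A S c (frac a s) (frac b t))"
    using well_defined assms frac_closed[of a s] frac_closed[of b t]
    by (simp add: ore_localization_well_defined_def ore_localization_def)
  moreover have "frac (c \<odot> (a \<otimes> y) \<oplus> b \<otimes> x) (s \<otimes> y)
      \<in> ore_lincomb_values A S c (frac a s) (frac b t)"
    using assms frac_self[of a s] frac_self[of b t] unfolding ore_lincomb_values_def by blast
  ultimately show ?thesis
    by (metis is_singleton_the_elem singletonD)
qed

text \<open>Over equal denominators the pair \<open>(\<one>, \<one>)\<close> is admissible. The
  common denominator lemmas reduce every sum to this case.\<close>

lemma add_frac:
  assumes "a \<in> carrier A" "s \<in> S" "b \<in> carrier A"
  shows "frac a s \<oplus>\<^bsub>Q\<^esub> frac b s = frac (a \<oplus> b) s"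
  using lincomb_frac[of a s b s \<one> \<one> 1] smult_one[of a] assms by (simp add: ore_localization_def)

lemma smult_frac:
  assumes "a \<in> carrier A" "s \<in> S"
  shows "c \<odot>\<^bsub>Q\<^esub> frac a s = frac (c \<odot> a) s"
  \<comment> \<open>Scalar multiplication is encoded as \<open>c X + [\<zero>, \<one>]\<close>; the
    admissible pair is \<open>(s, \<one>)\<close>, because
    \<open>s \<otimes> \<one> = \<one> \<otimes> s\<close>.\<close>
  using lincomb_frac[of a s \<zero> \<one> s \<one> c] assms by (simp add: ore_localization_def)

lemma mult_frac:
  assumes "a \<in> carrier A" "s \<in> S" "b \<in> carrier A" "t \<in> S" "x \<in> carrier A" "y \<in> S"
    and "b \<otimes> y = s \<otimes> x"
  shows "frac a s \<otimes>\<^bsub>Q\<^esub> frac b t = frac (a \<otimes> x) (t \<otimes> y)"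
proof -
  have "is_singleton (ore_mult_values A S (frac a s) (frac b t))"
    using well_defined assms frac_closed[of a s] frac_closed[of b t]
    by (simp add: ore_localization_well_defined_def ore_localization_def)
  moreover have "frac (a \<otimes> x) (t \<otimes> y) \<in> ore_mult_values A S (frac a s) (frac b t)"
    using assms frac_self[of a s] frac_self[of b t] unfolding ore_mult_values_def by blast
  ultimately show ?thesis
    unfolding ore_localization_def by (simp, metis is_singleton_the_elem singletonD)
qed

lemma one_frac: "\<one>\<^bsub>Q\<^esub> = frac \<one> \<one>"
  by (simp add: ore_localization_def)

text \<open>The factor \<open>u\<close> may lie outside \<open>S\<close> as long as
  \<open>s \<otimes> u\<close> is in \<open>S\<close>. This matters because the Ore condition places
  only one of its two multipliers in \<open>S\<close>.\<close>

lemma frac_expand: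
  assumes "a \<in> carrier A" "s \<in> S" "u \<in> carrier A" "s \<otimes> u \<in> S"
  shows "frac (a \<otimes> u) (s \<otimes> u) = frac a s"
  by (rule frac_eqI[where u = \<one> and v = u]) (use assms in auto)

lemma frac_same: "s \<in> S \<Longrightarrow> frac s s = \<one>\<^bsub>Q\<^esub>"
  using frac_expand[of \<one> \<one> s] by (simp add: one_frac)

lemma zero_frac: "s \<in> S \<Longrightarrow> frac \<zero> s = \<zero>\<^bsub>Q\<^esub>"
  using frac_expand[of \<zero> \<one> s] by (simp add: ore_localization_def)

text \<open>In an Ore relation \<open>s \<otimes> y = t \<otimes> x\<close> with \<open>y\<close> in
  \<open>S\<close>, the left side is in \<open>S\<close>, so both fractions expand to this
  denominator by \<open>frac_expand\<close>.\<close>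

lemma frac_common_denominator2:
  assumes "X \<in> carrier Q" "Y \<in> carrier Q"
  obtains a b s where "a \<in> carrier A" "b \<in> carrier A" "s \<in> S" "X = frac a s" "Y = frac b s"
proof -
  obtain a s b t where X: "a \<in> carrier A" "s \<in> S" "X = frac a s"
    and Y: "b \<in> carrier A" "t \<in> S" "Y = frac b t"
    using assms by (elim fracE)
  obtain x y where xy: "x \<in> carrier A" "y \<in> S" "s \<otimes> y = t \<otimes> x"
    using right_oreE[of s t] X Y by auto
  have st: "s \<otimes> y \<in> S"
    using X(2) xy(2) by simp
  have "X = frac (a \<otimes> y) (s \<otimes> y)"
    using frac_expand[of a s y] X xy st by simp
  moreover have "Y = frac (b \<otimes> x) (s \<otimes> y)"
    using frac_expand[of b t x] Y xy st by simp
  ultimately show thesis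
    using that[of "a \<otimes> y" "b \<otimes> x" "s \<otimes> y"] X Y xy st by simp
qed

lemma frac_common_denominator3:
  assumes "X \<in> carrier Q" "Y \<in> carrier Q" "Z \<in> carrier Q"
  obtains a b c s where "a \<in> carrier A" "b \<in> carrier A" "c \<in> carrier A" "s \<in> S"
    "X = frac a s" "Y = frac b s" "Z = frac c s"
proof -
  obtain a b s where X: "a \<in> carrier A" "b \<in> carrier A" "s \<in> S" "X = frac a s" "Y = frac b s"
    using assms(1,2) by (rule frac_common_denominator2)
  obtain c t where Z: "c \<in> carrier A" "t \<in> S" "Z = frac c t"
    using assms(3) by (rule fracE)
  obtain x y where xy: "x \<in> carrier A" "y \<in> S" "s \<otimes> y = t \<otimes> x"
    using right_oreE[of s t] X Z by auto
  have st: "s \<otimes> y \<in> S"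
    using X(3) xy(2) by simp
  have "X = frac (a \<otimes> y) (s \<otimes> y)" "Y = frac (b \<otimes> y) (s \<otimes> y)"
    using frac_expand[of a s y] frac_expand[of b s y] X xy st by simp_all
  moreover have "Z = frac (c \<otimes> x) (s \<otimes> y)"
    using frac_expand[of c t x] Z xy st by simp
  ultimately show thesis
    using that[of "a \<otimes> y" "b \<otimes> y" "c \<otimes> x" "s \<otimes> y"] X Z xy st by simp
qed

section \<open>The algebra axioms for the localization\<close>

lemma abelian_group_localization: "abelian_group Q"
proof (rule abelian_groupI)
  fix X Y assume "X \<in> carrier Q" "Y \<in> carrier Q"
  then obtain a b s where XY: "a \<in> carrier A" "b \<in> carrier A" "s \<in> S" "X = frac a s" "Y = frac b s"
    by (rule frac_common_denominator2)
  then show "X \<oplus>\<^bsub>Q\<^esub> Y \<in> carrier Q"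
    by (simp add: add_frac)
  show "X \<oplus>\<^bsub>Q\<^esub> Y = Y \<oplus>\<^bsub>Q\<^esub> X"
    using XY by (simp add: add_frac a_comm)
next
  fix X Y Z assume "X \<in> carrier Q" "Y \<in> carrier Q" "Z \<in> carrier Q"
  then obtain a b c s where "a \<in> carrier A" "b \<in> carrier A" "c \<in> carrier A" "s \<in> S"
    "X = frac a s" "Y = frac b s" "Z = frac c s"
    by (rule frac_common_denominator3)
  then show "X \<oplus>\<^bsub>Q\<^esub> Y \<oplus>\<^bsub>Q\<^esub> Z = X \<oplus>\<^bsub>Q\<^esub> (Y \<oplus>\<^bsub>Q\<^esub> Z)"
    by (simp add: add_frac a_assoc)
next
  show "\<zero>\<^bsub>Q\<^esub> \<in> carrier Q"
    using frac_closed[of \<zero> \<one>] by (simp add: zero_frac)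
next
  fix X assume "X \<in> carrier Q"
  then obtain a s where X: "a \<in> carrier A" "s \<in> S" "X = frac a s"
    by (elim fracE)
  then show "\<zero>\<^bsub>Q\<^esub> \<oplus>\<^bsub>Q\<^esub> X = X"
    using add_frac[of \<zero> s a] by (simp add: zero_frac)
  show "\<exists>Y \<in> carrier Q. Y \<oplus>\<^bsub>Q\<^esub> X = \<zero>\<^bsub>Q\<^esub>"
    by (rule bexI[of _ "frac (\<ominus> a) s"]) (use X in \<open>simp_all add: add_frac l_neg zero_frac\<close>)
qed

lemma monoid_localization: "monoid Q"
proof (rule monoidI)
  fix X Y assume "X \<in> carrier Q" "Y \<in> carrier Q"
  then obtain a s b t where XY: "a \<in> carrier A" "s \<in> S" "X = frac a s"
      "b \<in> carrier A" "t \<in> S" "Y = frac b t"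
    by (elim fracE)
  obtain x y where "x \<in> carrier A" "y \<in> S" "b \<otimes> y = s \<otimes> x"
    using XY(4,2) by (rule right_oreE)
  then show "X \<otimes>\<^bsub>Q\<^esub> Y \<in> carrier Q"
    using XY mult_frac[of a s b t x y] by simp
next
  show "\<one>\<^bsub>Q\<^esub> \<in> carrier Q"
    by (simp add: one_frac)
next
  fix X assume "X \<in> carrier Q"
  then obtain a s where X: "a \<in> carrier A" "s \<in> S" "X = frac a s"
    by (elim fracE)
  then show "\<one>\<^bsub>Q\<^esub> \<otimes>\<^bsub>Q\<^esub> X = X"
    using mult_frac[of \<one> \<one> a s a \<one>] by (simp add: one_frac)
  show "X \<otimes>\<^bsub>Q\<^esub> \<one>\<^bsub>Q\<^esub> = X"
    using mult_frac[of a s \<one> \<one> \<one> s] X by (simp add: one_frac)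
next
  fix X Y Z assume "X \<in> carrier Q" "Y \<in> carrier Q" "Z \<in> carrier Q"
  then obtain a s b t c r where [simp]: "a \<in> carrier A" "s \<in> S" "b \<in> carrier A" "t \<in> S"
      "c \<in> carrier A" "r \<in> S" and eqs: "X = frac a s" "Y = frac b t" "Z = frac c r"
    by (elim fracE)
  obtain x y where [simp]: "x \<in> carrier A" "y \<in> S" and xy: "b \<otimes> y = s \<otimes> x"
    using right_oreE[of b s] by auto
  \<comment> \<open>Resolving \<open>c\<close> against \<open>t \<otimes> y\<close>, the denominator
    of the product of \<open>X\<close> and \<open>Y\<close>, serves both bracketings: reassociated,
    it is the pair \<open>(y \<otimes> w, z)\<close> for the product of \<open>Y\<close> and
    \<open>Z\<close>. Then \<open>(x \<otimes> w, \<one>)\<close> is admissible for multiplying that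
    product by \<open>X\<close> from the left.\<close>
  obtain w z where [simp]: "w \<in> carrier A" "z \<in> S" and cz: "c \<otimes> z = t \<otimes> y \<otimes> w"
    using right_oreE[of c "t \<otimes> y"] by auto
  have "X \<otimes>\<^bsub>Q\<^esub> Y \<otimes>\<^bsub>Q\<^esub> Z = frac (a \<otimes> x \<otimes> w) (r \<otimes> z)"
    using mult_frac[of a s b t x y] mult_frac[of "a \<otimes> x" "t \<otimes> y" c r w z] xy cz by (simp add: eqs)
  moreover have "Y \<otimes>\<^bsub>Q\<^esub> Z = frac (b \<otimes> (y \<otimes> w)) (r \<otimes> z)"
    using mult_frac[of b t c r "y \<otimes> w" z] cz by (simp add: eqs m_assoc)
  moreover have "b \<otimes> (y \<otimes> w) \<otimes> \<one> = s \<otimes> (x \<otimes> w)"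
    using xy by (simp flip: m_assoc)
  then have "X \<otimes>\<^bsub>Q\<^esub> frac (b \<otimes> (y \<otimes> w)) (r \<otimes> z) = frac (a \<otimes> (x \<otimes> w)) (r \<otimes> z \<otimes> \<one>)"
    unfolding eqs by (intro mult_frac) simp_all
  ultimately show "X \<otimes>\<^bsub>Q\<^esub> Y \<otimes>\<^bsub>Q\<^esub> Z = X \<otimes>\<^bsub>Q\<^esub> (Y \<otimes>\<^bsub>Q\<^esub> Z)"
    by (simp add: m_assoc)
qed

lemma ring_localization: "ring Q"
proof (intro ringI abelian_group_localization monoid_localization)
  fix X Y Z assume Q: "X \<in> carrier Q" "Y \<in> carrier Q" "Z \<in> carrier Q"
  obtain a b s where [simp]: "a \<in> carrier A" "b \<in> carrier A" "s \<in> S"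
    and XY: "X = frac a s" "Y = frac b s"
    using Q(1,2) by (rule frac_common_denominator2)
  obtain c t where [simp]: "c \<in> carrier A" "t \<in> S" and Z: "Z = frac c t"
    using Q(3) by (rule fracE)
  {
    \<comment> \<open>All three left factors have denominator \<open>s\<close>, so one pair
      \<open>(x, y)\<close> computes all three products.\<close>
    obtain x y where [simp]: "x \<in> carrier A" "y \<in> S" and "c \<otimes> y = s \<otimes> x"
      using right_oreE[of c s] by auto
    then show "(X \<oplus>\<^bsub>Q\<^esub> Y) \<otimes>\<^bsub>Q\<^esub> Z = X \<otimes>\<^bsub>Q\<^esub> Z \<oplus>\<^bsub>Q\<^esub> Y \<otimes>\<^bsub>Q\<^esub> Z"
      by (simp add: XY Z add_frac mult_frac[where x = x and y = y] l_distr)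
  }
  obtain x y where [simp]: "x \<in> carrier A" "y \<in> S" and ay: "a \<otimes> y = t \<otimes> x"
    using right_oreE[of a t] by auto
  \<comment> \<open>The numerators \<open>a\<close> and \<open>b\<close> need the same right
    multiplier. Resolving \<open>b \<otimes> y\<close> instead of \<open>b\<close> makes
    \<open>y \<otimes> z\<close> work for both, and adding the two relations gives one for
    \<open>a \<oplus> b\<close>.\<close>
  obtain w z where [simp]: "w \<in> carrier A" "z \<in> S" and bz: "b \<otimes> y \<otimes> z = t \<otimes> w"
    using right_oreE[of "b \<otimes> y" t] by auto
  have a: "a \<otimes> (y \<otimes> z) = t \<otimes> (x \<otimes> z)"
    using ay by (simp flip: m_assoc)
  have b: "b \<otimes> (y \<otimes> z) = t \<otimes> w"
    using bz by (simp flip: m_assoc)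
  have "(a \<oplus> b) \<otimes> (y \<otimes> z) = t \<otimes> (x \<otimes> z \<oplus> w)"
    using a b by (simp add: l_distr r_distr)
  then show "Z \<otimes>\<^bsub>Q\<^esub> (X \<oplus>\<^bsub>Q\<^esub> Y) = Z \<otimes>\<^bsub>Q\<^esub> X \<oplus>\<^bsub>Q\<^esub> Z \<otimes>\<^bsub>Q\<^esub> Y"
    using mult_frac[OF _ _ _ _ _ _ a, of c s] mult_frac[OF _ _ _ _ _ _ b, of c s]
      mult_frac[of c t "a \<oplus> b" s "x \<otimes> z \<oplus> w" "y \<otimes> z"]
    by (simp add: XY Z add_frac r_distr)
qed

sublocale Q: ring Q
  by (rule ring_localization)

lemma module_localization: "module complex_ring Q"
proof (rule moduleI)
  show "cring complex_ring"
    by (rule R.is_cring)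
  show "abelian_group Q"
    by (rule abelian_group_localization)
next
  fix c X assume "X \<in> carrier Q"
  then show "c \<odot>\<^bsub>Q\<^esub> X \<in> carrier Q"
    by (auto simp: smult_frac elim!: fracE)
next
  fix c d X assume "X \<in> carrier Q"
  then obtain a s where X: "a \<in> carrier A" "s \<in> S" "X = frac a s"
    by (elim fracE)
  show "(c \<oplus>\<^bsub>complex_ring\<^esub> d) \<odot>\<^bsub>Q\<^esub> X = c \<odot>\<^bsub>Q\<^esub> X \<oplus>\<^bsub>Q\<^esub> d \<odot>\<^bsub>Q\<^esub> X"
    using X smult_l_distr[of c d a] by (simp add: smult_frac add_frac)
  show "(c \<otimes>\<^bsub>complex_ring\<^esub> d) \<odot>\<^bsub>Q\<^esub> X = c \<odot>\<^bsub>Q\<^esub> (d \<odot>\<^bsub>Q\<^esub> X)"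
    using X smult_assoc1[of c d a] by (simp add: smult_frac)
next
  fix c X Y assume "X \<in> carrier Q" "Y \<in> carrier Q"
  then obtain a b s where "a \<in> carrier A" "b \<in> carrier A" "s \<in> S" "X = frac a s" "Y = frac b s"
    by (rule frac_common_denominator2)
  then show "c \<odot>\<^bsub>Q\<^esub> (X \<oplus>\<^bsub>Q\<^esub> Y) = c \<odot>\<^bsub>Q\<^esub> X \<oplus>\<^bsub>Q\<^esub> c \<odot>\<^bsub>Q\<^esub> Y"
    using smult_r_distr[of c a b] by (simp add: smult_frac add_frac)
next
  fix X assume "X \<in> carrier Q"
  then show "\<one>\<^bsub>complex_ring\<^esub> \<odot>\<^bsub>Q\<^esub> X = X"
    using smult_one by (auto simp: smult_frac elim!: fracE)
qed

lemma complex_algebra_localization: "complex_algebra Q"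
proof (intro complex_algebra.intro complex_algebra_axioms.intro module_localization ring_localization)
  fix X Y c assume "X \<in> carrier Q" "Y \<in> carrier Q"
  then obtain a s b t where [simp]: "a \<in> carrier A" "s \<in> S" "b \<in> carrier A" "t \<in> S"
    and XY: "X = frac a s" "Y = frac b t"
    by (elim fracE)
  obtain x y where [simp]: "x \<in> carrier A" "y \<in> S" and xy: "b \<otimes> y = s \<otimes> x"
    using right_oreE[of b s] by auto
  show "c \<odot>\<^bsub>Q\<^esub> X \<otimes>\<^bsub>Q\<^esub> Y = c \<odot>\<^bsub>Q\<^esub> (X \<otimes>\<^bsub>Q\<^esub> Y)"
    using mult_frac[of "c \<odot> a" s b t x y] mult_frac[of a s b t x y] xy
    by (simp add: XY smult_frac smult_mult_left)
  show "X \<otimes>\<^bsub>Q\<^esub> (c \<odot>\<^bsub>Q\<^esub> Y) = c \<odot>\<^bsub>Q\<^esub> (X \<otimes>\<^bsub>Q\<^esub> Y)"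
    \<comment> \<open>Scaling the relation \<open>b \<otimes> y = s \<otimes> x\<close> by
      \<open>c\<close> shows that \<open>(c \<odot> x, y)\<close> is admissible for the scaled right
      factor.\<close>
    using mult_frac[of a s "c \<odot> b" t "c \<odot> x" y] mult_frac[of a s b t x y] xy
    by (simp add: XY smult_frac smult_mult_left smult_mult_right)
qed

section \<open>Inverses of denominators and left fractions\<close>

lemma frac_one_mult:
  assumes "a \<in> carrier A" "b \<in> carrier A"
  shows "frac (a \<otimes> b) \<one> = frac a \<one> \<otimes>\<^bsub>Q\<^esub> frac b \<one>"
  using mult_frac[of a \<one> b \<one> b \<one>] assms by simp

lemma frac_conv_mult:
  assumes "a \<in> carrier A" "s \<in> S"
  shows "frac a s = frac a \<one> \<otimes>\<^bsub>Q\<^esub> frac \<one> s"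
  using mult_frac[of a \<one> \<one> s \<one> \<one>] assms by simp

lemma denominator_inverse:
  assumes "s \<in> S"
  shows "frac s \<one> \<otimes>\<^bsub>Q\<^esub> frac \<one> s = \<one>\<^bsub>Q\<^esub>" "frac \<one> s \<otimes>\<^bsub>Q\<^esub> frac s \<one> = \<one>\<^bsub>Q\<^esub>"
  using assms frac_conv_mult[of s s] frac_same[of s] mult_frac[of \<one> s s \<one> \<one> \<one>]
  by (simp_all add: one_frac)

text \<open>A left inverse coincides with any right inverse, and \<open>frac \<one> s\<close> is a
  right inverse of \<open>frac s \<one>\<close>.\<close>

lemma inverse_frac_eqI:
  assumes "s \<in> S" "X \<in> carrier Q" "X \<otimes>\<^bsub>Q\<^esub> frac s \<one> = \<one>\<^bsub>Q\<^esub>"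
  shows "X = frac \<one> s"
  using Q.inv_unique[of X "frac s \<one>" "frac \<one> s"] assms by (simp add: denominator_inverse)

lemma inverse_frac_mult:
  assumes "s \<in> S" "t \<in> S"
  shows "frac \<one> (s \<otimes> t) = frac \<one> t \<otimes>\<^bsub>Q\<^esub> frac \<one> s"
  using mult_frac[of \<one> t \<one> s \<one> t] assms by simp

text \<open>The counterpart of \<open>frac_expand\<close> for left fractions. As \<open>u\<close>
  itself may lie outside \<open>S\<close>, it is not inverted; instead
  \<open>frac \<one> (u \<otimes> s)\<close> times \<open>frac u \<one>\<close> is recognized as a
  left inverse of \<open>frac s \<one>\<close>.\<close>

lemma left_frac_cancel:
  assumes "s \<in> S" "u \<in> carrier A" "a \<in> carrier A" "u \<otimes> s \<in> S"
  shows "frac \<one> (u \<otimes> s) \<otimes>\<^bsub>Q\<^esub> frac (u \<otimes> a) \<one> = frac \<one> s \<otimes>\<^bsub>Q\<^esub> frac a \<one>"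
proof -
  have "frac \<one> (u \<otimes> s) \<otimes>\<^bsub>Q\<^esub> frac u \<one> \<otimes>\<^bsub>Q\<^esub> frac s \<one> = \<one>\<^bsub>Q\<^esub>"
    using assms frac_one_mult[of u s] denominator_inverse(2)[of "u \<otimes> s"]
    by (simp add: Q.m_assoc)
  then have "frac \<one> (u \<otimes> s) \<otimes>\<^bsub>Q\<^esub> frac u \<one> = frac \<one> s"
    using assms by (intro inverse_frac_eqI) simp_all
  then show ?thesis
    using assms by (simp add: frac_one_mult flip: Q.m_assoc)
qed

text \<open>Converts a right fraction into a left one: map
  \<open>y \<otimes> b = x \<otimes> s\<close> into the localization, then cancel \<open>y\<close>
  on the left and \<open>s\<close> on the right.\<close>

lemma left_frac_commute:
  assumes "s \<in> S" "y \<in> S" "b \<in> carrier A" "x \<in> carrier A" "y \<otimes> b = x \<otimes> s"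
  shows "frac b \<one> \<otimes>\<^bsub>Q\<^esub> frac \<one> s = frac \<one> y \<otimes>\<^bsub>Q\<^esub> frac x \<one>"
proof -
  have "frac b \<one> \<otimes>\<^bsub>Q\<^esub> frac \<one> s
      = (frac \<one> y \<otimes>\<^bsub>Q\<^esub> frac y \<one>) \<otimes>\<^bsub>Q\<^esub> frac b \<one> \<otimes>\<^bsub>Q\<^esub> frac \<one> s"
    using assms by (simp add: denominator_inverse)
  also have "\<dots> = frac \<one> y \<otimes>\<^bsub>Q\<^esub> frac (x \<otimes> s) \<one> \<otimes>\<^bsub>Q\<^esub> frac \<one> s"
    using assms frac_one_mult[of y b] by (simp add: Q.m_assoc)
  also have "\<dots> = frac \<one> y \<otimes>\<^bsub>Q\<^esub> frac x \<one>"
    using assms by (simp add: frac_one_mult Q.m_assoc denominator_inverse)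
  finally show ?thesis .
qed

lemma ring_hom_localization: "(\<lambda>a. frac a \<one>) \<in> ring_hom A Q"
  by (rule ring_hom_memI) (simp_all add: frac_one_mult add_frac one_frac)

end

section \<open>The involution on the localization\<close>

lemma (in involutive_algebra) star_one: "star \<one> = \<one>"
proof -
  \<comment> \<open>Preservation of the unit comes from antimultiplicativity: the factor inserted on
    the left is \<open>star (star \<one>) = \<one>\<close>.\<close>
  have "star \<one> = star (star \<one>) \<otimes> star \<one>"
    by (simp add: star_star star_closed)
  also have "\<dots> = star (\<one> \<otimes> star \<one>)"
    by (rule star_mult[symmetric]) (simp_all add: star_closed)
  also have "\<dots> = \<one>"
    by (simp add: star_star star_closed)
  finally show ?thesis .
qed

locale involutive_ore_localizable =
  involutive_algebra A star + ore_localizable A S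
  for A :: "(complex, 'a, 'm) module_scheme" (structure) and star :: "'a \<Rightarrow> 'a" and S :: "'a set" +
  assumes star_denominators: "star ` S = S"
begin

abbreviation Qstar :: "('a \<times> 'a) set \<Rightarrow> ('a \<times> 'a) set"
  where "Qstar \<equiv> ore_star A S star"

lemma star_mem [simp]: "s \<in> S \<Longrightarrow> star s \<in> S"
  using star_denominators by blast

declare star_closed [simp] star_star [simp]

text \<open>\<open>ore_star\<close> is \<open>the_elem\<close> of the values over all
  representatives, so independence of the representative must be shown before the formula can be
  used.\<close>

lemma Qstar_frac:
  assumes "a \<in> carrier A" "s \<in> S"
  shows "Qstar (frac a s) = frac \<one> (star s) \<otimes>\<^bsub>Q\<^esub> frac (star a) \<one>"
proof -
  have "frac \<one> (star t) \<otimes>\<^bsub>Q\<^esub> frac (star b) \<one> = frac \<one> (star s) \<otimes>\<^bsub>Q\<^esub> frac (star a) \<one>"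
    if "(b, t) \<in> frac a s" for b t
  proof -
    from that obtain u v where uv: "b \<in> carrier A" "t \<in> S" "u \<in> carrier A" "v \<in> carrier A"
      "a \<otimes> u = b \<otimes> v" "s \<otimes> u = t \<otimes> v" "s \<otimes> u \<in> S"
      by (elim mem_fracE)
    \<comment> \<open>The star turns the common right expansion of the two representatives into a
      common left expansion, to which \<open>left_frac_cancel\<close> applies on both sides.\<close>
    have eqs: "star u \<otimes> star a = star v \<otimes> star b" "star u \<otimes> star s = star v \<otimes> star t"
      using uv assms by (simp_all flip: star_mult)
    have mem: "star u \<otimes> star s \<in> S"
      using star_mem[OF uv(7)] star_mult[of s u] uv(3) assms by simp
    show ?thesis
      using left_frac_cancel[of "star s" "star u" "star a"]
        left_frac_cancel[of "star t" "star v" "star b"] uv(1-4) assms eqs mem by simp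
  qed
  then have "{frac \<one> (star t) \<otimes>\<^bsub>Q\<^esub> frac (star b) \<one> | b t. (b, t) \<in> frac a s}
      = {frac \<one> (star s) \<otimes>\<^bsub>Q\<^esub> frac (star a) \<one>}"
    using frac_self[OF assms] by blast
  then show ?thesis
    by (simp add: ore_star_def)
qed

lemma Qstar_closed: "X \<in> carrier Q \<Longrightarrow> Qstar X \<in> carrier Q"
  by (auto simp: Qstar_frac elim!: fracE)

lemma Qstar_numerator: "a \<in> carrier A \<Longrightarrow> Qstar (frac a \<one>) = frac (star a) \<one>"
  by (simp add: Qstar_frac star_one flip: one_frac)

lemma Qstar_denominator: "s \<in> S \<Longrightarrow> Qstar (frac \<one> s) = frac \<one> (star s)"
  by (simp add: Qstar_frac star_one flip: one_frac)

lemma Qstar_mult: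
  assumes "X \<in> carrier Q" "Y \<in> carrier Q"
  shows "Qstar (X \<otimes>\<^bsub>Q\<^esub> Y) = Qstar Y \<otimes>\<^bsub>Q\<^esub> Qstar X"
proof -
  obtain a s b t where [simp]: "a \<in> carrier A" "s \<in> S" "b \<in> carrier A" "t \<in> S"
    and XY: "X = frac a s" "Y = frac b t"
    using assms by (elim fracE)
  obtain x y where [simp]: "x \<in> carrier A" "y \<in> S" and xy: "b \<otimes> y = s \<otimes> x"
    using right_oreE[of b s] by auto
  \<comment> \<open>Starring \<open>b \<otimes> y = s \<otimes> x\<close> gives
    \<open>star y \<otimes> star b = star x \<otimes> star s\<close>. This is the relation that
    moves the inverse in the middle of the product of \<open>Qstar Y\<close> and
    \<open>Qstar X\<close> to the left.\<close>
  have comm: "frac (star b) \<one> \<otimes>\<^bsub>Q\<^esub> frac \<one> (star s) = frac \<one> (star y) \<otimes>\<^bsub>Q\<^esub> frac (star x) \<one>"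
    using xy by (intro left_frac_commute) (simp_all flip: star_mult)
  have "Qstar Y \<otimes>\<^bsub>Q\<^esub> Qstar X
      = frac \<one> (star t) \<otimes>\<^bsub>Q\<^esub> (frac (star b) \<one> \<otimes>\<^bsub>Q\<^esub> frac \<one> (star s)) \<otimes>\<^bsub>Q\<^esub> frac (star a) \<one>"
    by (simp add: XY Qstar_frac Q.m_assoc)
  also have "\<dots> = (frac \<one> (star t) \<otimes>\<^bsub>Q\<^esub> frac \<one> (star y))
      \<otimes>\<^bsub>Q\<^esub> (frac (star x) \<one> \<otimes>\<^bsub>Q\<^esub> frac (star a) \<one>)"
    unfolding comm by (simp add: Q.m_assoc)
  also have "\<dots> = Qstar (frac (a \<otimes> x) (t \<otimes> y))"
    by (simp add: Qstar_frac star_mult frac_one_mult inverse_frac_mult)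
  also have "\<dots> = Qstar (X \<otimes>\<^bsub>Q\<^esub> Y)"
    using xy by (simp add: XY mult_frac[of a s b t x y])
  finally show ?thesis
    by simp
qed

lemma Qstar_Qstar:
  assumes "X \<in> carrier Q"
  shows "Qstar (Qstar X) = X"
proof -
  obtain a s where "a \<in> carrier A" "s \<in> S" "X = frac a s"
    using assms by (elim fracE)
  then show ?thesis
    \<comment> \<open>Since \<open>Qstar\<close> reverses products, it suffices to apply it to the
      factors \<open>frac \<one> (star s)\<close> and \<open>frac (star a) \<one>\<close>; the
      result is the factorization of \<open>frac a s\<close> in
      \<open>frac_conv_mult\<close>.\<close>
    by (simp add: Qstar_frac[of a s] Qstar_mult Qstar_numerator Qstar_denominator frac_conv_mult[of a s])
qed

lemma involutive_algebra_localization: "involutive_algebra Q Qstar"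
proof -
  interpret QA: complex_algebra Q
    by (rule complex_algebra_localization)
  show ?thesis
  proof (intro involutive_algebra.intro involutive_algebra_axioms.intro
      complex_algebra_localization Qstar_closed Qstar_mult Qstar_Qstar)
    fix X Y assume "X \<in> carrier Q" "Y \<in> carrier Q"
    then obtain a b s where "a \<in> carrier A" "b \<in> carrier A" "s \<in> S" "X = frac a s" "Y = frac b s"
      by (rule frac_common_denominator2)
    then show "Qstar (X \<oplus>\<^bsub>Q\<^esub> Y) = Qstar X \<oplus>\<^bsub>Q\<^esub> Qstar Y"
      \<comment> \<open>Over a common denominator both starred fractions share the left factor
        \<open>frac \<one> (star s)\<close>, so additivity reduces to distributivity in the
        localization.\<close>
      using add_frac[of "star a" \<one> "star b"]
        Q.r_distr[of "frac (star a) \<one>" "frac (star b) \<one>" "frac \<one> (star s)"]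
      by (simp add: add_frac Qstar_frac star_add)
  next
    fix X c assume "X \<in> carrier Q"
    then obtain a s where "a \<in> carrier A" "s \<in> S" "X = frac a s"
      by (elim fracE)
    then show "Qstar (c \<odot>\<^bsub>Q\<^esub> X) = cnj c \<odot>\<^bsub>Q\<^esub> Qstar X"
      using smult_frac[of "star a" \<one> "cnj c"]
        QA.smult_mult_right[of "frac \<one> (star s)" "frac (star a) \<one>" "cnj c"]
      by (simp add: smult_frac Qstar_frac star_smult)
  qed
qed

lemma localization_hom:
  "(\<lambda>a. frac a \<one>) \<in> involutive_algebra_hom A star Q Qstar"
  by (simp add: involutive_algebra_hom_def ring_hom_localization smult_frac Qstar_numerator)

end

theorem proposition3p10:
  fixes A :: "(complex, 'a, 'm) module_scheme" and star :: "'a \<Rightarrow> 'a" and S :: "'a set"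
  assumes "involutive_algebra A star"
    and "ore_set A S"
    and "star ` S = S"
    and "ore_localization_well_defined A S"
  shows "(\<forall>a \<in> carrier A. \<forall>s \<in> S.
      ore_star A S star (ore_frac A S a s) =
        ore_frac A S \<one>\<^bsub>A\<^esub> (star s) \<otimes>\<^bsub>ore_localization A S\<^esub> ore_frac A S (star a) \<one>\<^bsub>A\<^esub>) \<and>
    involutive_algebra (ore_localization A S) (ore_star A S star) \<and>
    (\<lambda>a. ore_frac A S a \<one>\<^bsub>A\<^esub>)
      \<in> involutive_algebra_hom A star (ore_localization A S) (ore_star A S star)"
proof -
  interpret A: involutive_algebra A star by fact
  interpret involutive_ore_localizable A star S
    by unfold_locales (use assms in simp_all)
  show ?thesis
    using Qstar_frac involutive_algebra_localization localization_hom by blast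
qed

end
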